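(* Let $f\in\mathrm{Per}(\mathbb{F}_3^2)\setminus\mathrm{AGL}(2,\mathbb{F}_3)$. Then $1\text{-coaffinity}(f)\ge 6$. Moreover, letting $\tau$ be any transposition of $\mathbb{F}_3^2$, equality holds if and only if $f\in\mathrm{AGL}(2,\mathbb{F}_3)\circ\tau\circ\mathrm{AGL}(2,\mathbb{F}_3)$.
   Context: $\mathrm{Per}(\mathbb{F}_3^2)$ is the group of permutations of $\mathbb{F}_3^2$ and $\mathrm{AGL}(2,\mathbb{F}_3)$ the group of invertible affine maps of $\mathbb{F}_3^2$. A line is a coset of a $1$-dimensional subspace. $1\text{-coaffinity}(f)$ is the number of lines $L$ such that $f(L)$ is not a line. A transposition interchanges two distinct points and fixes all others; $\mathrm{AGL}\circ\tau\circ\mathrm{AGL}=\{\alpha\circ\tau\circ\beta:\alpha,\beta\in\mathrm{AGL}(2,\mathbb{F}_3)\}$. *)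

theory Defs
  imports "HOL-Analysis.Cartesian_Space" "HOL-Combinatorics.Transposition"
begin

definition AGL :: "('k::field ^ 'n \<Rightarrow> 'k ^ 'n) set" where
  "AGL = {f. \<exists>(A :: 'k ^ 'n ^ 'n) b. invertible A \<and> f = (\<lambda>x. A *v x + b)}"

definition is_line :: "('k::field ^ 'n) set \<Rightarrow> bool" where
  "is_line L \<longleftrightarrow> (\<exists>S a. vec.subspace S \<and> vec.dim S = 1 \<and> L = (\<lambda>x. a + x) ` S)"

definition one_coaffinity :: "('k::{field,finite} ^ 'n \<Rightarrow> 'k ^ 'n) \<Rightarrow> nat" where
  "one_coaffinity f = card {L. is_line L \<and> \<not> is_line (f ` L)}"

text \<open>\<open>Transposition.transpose\<close> swaps two points; it is not the matrix transpose.\<close>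

definition is_transposition :: "('a \<Rightarrow> 'a) \<Rightarrow> bool" where
  "is_transposition t \<longleftrightarrow> (\<exists>a b. a \<noteq> b \<and> t = Transposition.transpose a b)"

definition AGL_double_coset :: "('k::field ^ 'n \<Rightarrow> 'k ^ 'n) \<Rightarrow> ('k ^ 'n \<Rightarrow> 'k ^ 'n) set" where
  "AGL_double_coset t = {\<alpha> \<circ> t \<circ> \<beta> |\<alpha> \<beta>. \<alpha> \<in> AGL \<and> \<beta> \<in> AGL}"

end

theory Submission
  imports Defs
begin

text \<open>
  Over a field with three elements, three distinct points form a line iff their sum is 0, so a line
  is good (its image is a line) iff \<open>f\<close> sums to 0 over it. As \<open>f\<close> sums to 0 over the plane, so do its
  line sums over a parallel class and over the four lines through a point: neither family has
  exactly one bad line. If at most 6 of the 12 lines are bad, then some direction consists of good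
  lines only. If a second direction does too, bijectivity forces \<open>f\<close> to be affine. Otherwise each of
  the other three directions has exactly one good line, so exactly 6 lines are bad, and the three
  good lines are concurrent. Solving the six linear equations, \<open>f\<close> is affine up to swapping the
  two other points on the line of the full direction through the common point.
\<close>

section \<open>Fields with three elements and groups of exponent 3\<close>

lemma card3_field:
  assumes "CARD('k::{field,finite}) = 3"
  shows "(UNIV :: 'k set) = {0, 1, -1}" and "(1::'k) + 1 = -1" and "(1::'k) \<noteq> -1"
proof -
  have "\<exists>x::'k. x \<notin> {0, 1}"
  proof (rule ccontr)
    assume "\<nexists>x::'k. x \<notin> {0, 1}"
    then have "(UNIV :: 'k set) = {0, 1}" by auto
    then have "CARD('k) = card {0, 1 :: 'k}" by simp
    then show False using assms by simp
  qed
  then obtain x :: 'k where x: "x \<noteq> 0" "x \<noteq> 1" by auto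
  have U: "{0, 1, x} = UNIV"
    by (rule card_subset_eq) (use assms x in auto)
  \<comment> \<open>\<open>x + 1\<close> is neither \<open>1\<close> nor \<open>x\<close>, since
    \<open>x\<close> and \<open>1\<close> are nonzero.\<close>
  have "x + 1 \<in> {0, 1, x}" using U by auto
  then have "x + 1 = 0" using x by auto
  then have xm: "x = -1" by (simp add: eq_neg_iff_add_eq_0)
  show U': "(UNIV :: 'k set) = {0, 1, -1}" using U xm by simp
  show ne: "(1::'k) \<noteq> -1" using x xm by simp
  have "(1::'k) + 1 \<in> {0, 1, -1}" using U' by auto
  moreover have "(1::'k) + 1 \<noteq> 1" by (metis add_cancel_right_right zero_neq_one)
  moreover have "(1::'k) + 1 \<noteq> 0" using ne eq_neg_iff_add_eq_0 by blast
  ultimately show "(1::'k) + 1 = -1" by blast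
qed

lemma exponent3_vec:
  fixes x :: "'k::{field,finite} ^ 'n"
  assumes "CARD('k) = 3"
  shows "x + x + x = 0"
proof -
  have "x + x + x = (1 + 1 + 1) *s x"
    by (simp only: vector_sadd_rdistrib vector_smult_lid)
  then show ?thesis using card3_field(2)[OF assms] by simp
qed

text \<open>These rewrite rules decide equations in a group of exponent 3 by eliminating subtraction.\<close>

lemma exponent3_simps:
  fixes x y :: "'v::ab_group_add"
  assumes "\<And>z::'v. z + z + z = 0"
  shows "- x = x + x" "x - y = x + (y + y)"
    "x + (x + x) = 0" "x + (x + (x + y)) = y"
    "(x + y) + z = x + (y + z)" "x + y = y + x" "x + (y + z) = y + (x + z)"
    "x + 0 = x" "0 + x = x"
proof -
  show 1: "- x = x + x" for x :: 'v
    using assms[of x] by (metis add_eq_0_iff2)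
  show "x - y = x + (y + y)" by (simp only: diff_conv_add_uminus 1)
  show "x + (x + x) = 0" using assms[of x] by (simp add: add.assoc)
  show "x + (x + (x + y)) = y" using assms[of x] by (simp flip: add.assoc)
qed (simp_all add: ac_simps)

section \<open>Lines and affine maps as zero-sum conditions\<close>

lemma is_line_iff_range:
  "is_line L \<longleftrightarrow> (\<exists>a v. v \<noteq> 0 \<and> L = range (\<lambda>s. a + s *s v))"
proof
  assume "is_line L"
  then obtain S a where S: "vec.subspace S" "vec.dim S = 1" "L = (\<lambda>x. a + x) ` S"
    unfolding is_line_def by blast
  obtain B where B: "B \<subseteq> S" "vec.independent B" "S \<subseteq> vec.span B" "card B = vec.dim S"
    by (rule vec.basis_exists)
  with S(2) obtain v where v: "B = {v}" by (metis One_nat_def card_1_singletonE)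
  have "v \<noteq> 0" using B(2) v vec.dependent_zero by auto
  moreover have "S = vec.span {v}"
    using B(1,3) S(1) v vec.span_minimal by blast
  ultimately show "\<exists>a v. v \<noteq> 0 \<and> L = range (\<lambda>s. a + s *s v)"
    using S(3) by (auto simp: vec.span_singleton image_image)
next
  assume "\<exists>a v. v \<noteq> 0 \<and> L = range (\<lambda>s. a + s *s v)"
  then obtain a v where v: "v \<noteq> 0" "L = range (\<lambda>s. a + s *s v)" by blast
  have "L = (\<lambda>x. a + x) ` vec.span {v}" using v(2) by (simp add: vec.span_singleton image_image)
  moreover have "vec.dim (vec.span {v}) = 1" using v(1) by simp
  ultimately show "is_line L" unfolding is_line_def using vec.subspace_span by blast
qed

text \<open>A line consists of \<open>a\<close>, \<open>a + v\<close> and \<open>a - v\<close>, with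
  sum three times \<open>a\<close>, which is 0. Conversely, if the sum is 0, then
  \<open>z = - (x + y)\<close> equals \<open>x - (y - x)\<close>, the third point of the line
  through \<open>x\<close> in direction \<open>y - x\<close>.\<close>

lemma is_line_iff_sum_eq_0:
  fixes x y z :: "'k::{field,finite} ^ 'n"
  assumes k: "CARD('k) = 3" and d: "x \<noteq> y" "x \<noteq> z" "y \<noteq> z"
  shows "is_line {x, y, z} \<longleftrightarrow> x + y + z = 0"
proof
  note s = exponent3_simps[OF exponent3_vec[OF k]]
  assume "is_line {x, y, z}"
  then obtain a v where v: "v \<noteq> 0" "{x, y, z} = range (\<lambda>s. a + s *s v)"
    unfolding is_line_iff_range by blast
  have "{x, y, z} = {a, a + v, a - v}"
    using v(2) by (simp add: card3_field(1)[OF k] vector_smult_lneg)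
  then have "\<Sum>{x, y, z} = \<Sum>{a, a + v, a - v}" by simp
  moreover have "a \<noteq> a + v" "a \<noteq> a - v" using v by auto
  moreover have "a + v \<noteq> a - v"
  proof
    assume "a + v = a - v"
    then have "v = - v" by simp
    then have "v + v = 0" by (simp add: eq_neg_iff_add_eq_0)
    then show False using v(1) exponent3_vec[OF k, of v] by simp
  qed
  ultimately have "x + (y + z) = a + ((a + v) + (a - v))"
    using d by simp
  also have "\<dots> = 0" by (simp only: s)
  finally show "x + y + z = 0" by (simp add: add.assoc)
next
  note s = exponent3_simps[OF exponent3_vec[OF k]]
  assume 0: "x + y + z = 0"
  have "z = - (x + y)" using 0 by (metis add_eq_0_iff)
  also have "\<dots> = x - (y - x)" by (simp only: s)
  finally have "{x, y, z} = {x, x + (y - x), x - (y - x)}" by simp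
  also have "\<dots> = range (\<lambda>s. x + s *s (y - x))"
    by (simp add: card3_field(1)[OF k] vector_smult_lneg)
  finally show "is_line {x, y, z}" unfolding is_line_iff_range
    using d(1) by (metis right_minus_eq)
qed

text \<open>The condition at \<open>y = 0\<close> makes \<open>g x = f x - f 0\<close> odd; the
  general condition then makes \<open>g\<close> additive. As the only scalars are 0, 1 and -1, this
  is already linearity.\<close>

lemma AGL_iff_sum_eq_0:
  fixes f :: "'k::{field,finite} ^ 'n \<Rightarrow> 'k ^ 'n"
  assumes k: "CARD('k) = 3"
  shows "f \<in> AGL \<longleftrightarrow> bij f \<and> (\<forall>x y. f x + f y + f (- (x + y)) = 0)"
proof
  note s = exponent3_simps[OF exponent3_vec[OF k]]
  assume "f \<in> AGL"
  then obtain A :: "'k ^ 'n ^ 'n" and b where A: "invertible A" and f: "f = (\<lambda>x. A *v x + b)"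
    unfolding AGL_def by blast
  have "inj ((*v) A)"
    using A by (simp add: invertible_left_inverse matrix_left_invertible_injective)
  then have "inj f" by (auto simp: f inj_def)
  then have "bij f" by (simp add: bij_def finite_UNIV_inj_surj)
  moreover have "f x + f y + f (- (x + y)) = 0" for x y
  proof -
    have "A *v (- (x + y)) = - (A *v (x + y))"
      by (rule vec.linear_neg[OF matrix_vector_mul_linear_gen])
    then show ?thesis by (simp only: f matrix_vector_right_distrib) (simp only: s)
  qed
  ultimately show "bij f \<and> (\<forall>x y. f x + f y + f (- (x + y)) = 0)" by blast
next
  note s = exponent3_simps[OF exponent3_vec[OF k]]
  assume a: "bij f \<and> (\<forall>x y. f x + f y + f (- (x + y)) = 0)"
  define g where "g x = f x - f 0" for x
  have fm: "f (- (x + y)) = - (f x + f y)" for x y using a by (metis add_eq_0_iff)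
  have gm: "g (- x) = - g x" for x
  proof -
    have "f (- x) = - (f x + f 0)" using fm[of x 0] by simp
    then show ?thesis unfolding g_def by (simp only:) (simp only: s)
  qed
  have gadd: "g (x + y) = g x + g y" for x y
  proof -
    have "g (x + y) = - g (- (x + y))" unfolding gm by simp
    also have "\<dots> = g x + g y" unfolding g_def fm by (simp only: s)
    finally show ?thesis .
  qed
  have "g (c *s x) = c *s g x" for c x
  proof -
    have "c \<in> {0, 1, -1}" using card3_field(1)[OF k] by auto
    then show ?thesis using gm by (auto simp: g_def vector_smult_lneg)
  qed
  then have lin: "Vector_Spaces.linear (*s) (*s) g"
    using gadd by unfold_locales auto
  have "inj g" using a by (auto simp: g_def inj_def bij_def)
  then have "invertible (matrix g)"
    using lin by (simp add: invertible_left_inverse matrix_left_invertible_injective)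
  moreover have "f = (\<lambda>x. matrix g *v x + f 0)"
    using matrix_works[OF lin] by (simp add: fun_eq_iff g_def)
  ultimately show "f \<in> AGL" unfolding AGL_def by blast
qed

section \<open>The affine group and its action on lines\<close>

lemma AGL_comp:
  assumes k: "CARD('k::{field,finite}) = 3"
    and f: "(f :: 'k ^ 'n \<Rightarrow> 'k ^ 'n) \<in> AGL" and g: "g \<in> AGL"
  shows "f \<circ> g \<in> AGL"
proof -
  have "g (- (x + y)) = - (g x + g y)" for x y
    using g unfolding AGL_iff_sum_eq_0[OF k] by (metis add_eq_0_iff)
  then show ?thesis using f g unfolding AGL_iff_sum_eq_0[OF k]
    by (auto intro: bij_comp)
qed

lemma AGL_inv:
  assumes k: "CARD('k::{field,finite}) = 3"
    and f: "(f :: 'k ^ 'n \<Rightarrow> 'k ^ 'n) \<in> AGL"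
  shows "inv f \<in> AGL"
proof -
  have b: "bij f" and fm: "f (- (x + y)) = - (f x + f y)" for x y
    using f unfolding AGL_iff_sum_eq_0[OF k] by (auto simp: add_eq_0_iff)
  have "inv f x + inv f y + inv f (- (x + y)) = 0" for x y
  proof -
    have "f (- (inv f x + inv f y)) = - (x + y)"
      using b by (simp only: fm bij_is_surj surj_f_inv_f)
    then have "inv f (- (x + y)) = - (inv f x + inv f y)"
      using b by (metis bij_inv_eq_iff)
    then show ?thesis by simp
  qed
  then show ?thesis unfolding AGL_iff_sum_eq_0[OF k] using b bij_imp_bij_inv by blast
qed

lemma is_line_AGL_image:
  assumes "f \<in> AGL" and "is_line L"
  shows "is_line (f ` L)"
proof -
  obtain A b where A: "invertible A" and f: "f = (\<lambda>x. A *v x + b)"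
    using assms(1) unfolding AGL_def by blast
  obtain a v where v: "v \<noteq> 0" "L = range (\<lambda>s. a + s *s v)"
    using assms(2) unfolding is_line_iff_range by blast
  have "f ` L = range (\<lambda>s. f a + s *s (A *v v))"
    unfolding v f image_image
    by (simp add: matrix_vector_right_distrib vector_scalar_commute add_ac)
  moreover have "A *v v \<noteq> 0"
    using A v(1) by (metis invertible_left_inverse matrix_left_invertible_ker)
  ultimately show ?thesis unfolding is_line_iff_range by blast
qed

lemma is_line_AGL_image_iff:
  assumes k: "CARD('k::{field,finite}) = 3"
    and f: "(f :: 'k ^ 'n \<Rightarrow> 'k ^ 'n) \<in> AGL"
  shows "is_line (f ` L) \<longleftrightarrow> is_line L"
proof
  have "bij f" using f unfolding AGL_iff_sum_eq_0[OF k] by blast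
  then have "inv f ` f ` L = L" by (simp add: bij_is_inj image_inv_f_f)
  then show "is_line (f ` L) \<Longrightarrow> is_line L"
    using is_line_AGL_image[OF AGL_inv[OF k f], of "f ` L"] by simp
qed (rule is_line_AGL_image[OF f])

text \<open>\<open>\<alpha>\<close> preserves and reflects lines, so a line is bad for the composite
  exactly when its image under \<open>\<beta>\<close> is bad for \<open>t\<close>. As
  \<open>\<beta>\<close> permutes the lines, it matches the two sets of bad lines.\<close>

lemma one_coaffinity_AGL_comp:
  fixes t :: "'k::{field,finite} ^ 'n \<Rightarrow> 'k ^ 'n"
  assumes k: "CARD('k) = 3" and a: "\<alpha> \<in> AGL" and b: "\<beta> \<in> AGL"
  shows "one_coaffinity (\<alpha> \<circ> t \<circ> \<beta>) = one_coaffinity t"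
proof -
  have im: "(\<alpha> \<circ> t \<circ> \<beta>) ` L = \<alpha> ` t ` \<beta> ` L" for L
    by (simp add: image_comp)
  have bb: "bij \<beta>" using b unfolding AGL_iff_sum_eq_0[OF k] by blast
  have "bij_betw ((`) \<beta>) {L. is_line L \<and> \<not> is_line ((\<alpha> \<circ> t \<circ> \<beta>) ` L)}
     {L. is_line L \<and> \<not> is_line (t ` L)}"
  proof (rule bij_betw_byWitness[where f' = "(`) (inv \<beta>)"])
    show "\<forall>L \<in> {L. is_line L \<and> \<not> is_line ((\<alpha> \<circ> t \<circ> \<beta>) ` L)}. inv \<beta> ` \<beta> ` L = L"
      using bb by (simp add: bij_is_inj image_inv_f_f)
    have i: "\<beta> ` inv \<beta> ` L = L" for L
      using bb by (simp add: bij_is_surj image_f_inv_f)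
    then show "\<forall>L \<in> {L. is_line L \<and> \<not> is_line (t ` L)}. \<beta> ` inv \<beta> ` L = L" by blast
    show "(`) \<beta> ` {L. is_line L \<and> \<not> is_line ((\<alpha> \<circ> t \<circ> \<beta>) ` L)} \<subseteq> {L. is_line L \<and> \<not> is_line (t ` L)}"
      unfolding im by (auto simp: is_line_AGL_image_iff[OF k a] is_line_AGL_image_iff[OF k b])
    show "(`) (inv \<beta>) ` {L. is_line L \<and> \<not> is_line (t ` L)} \<subseteq> {L. is_line L \<and> \<not> is_line ((\<alpha> \<circ> t \<circ> \<beta>) ` L)}"
      unfolding im by (auto simp: is_line_AGL_image_iff[OF k a] i
         is_line_AGL_image_iff[OF k AGL_inv[OF k b]])
  qed
  then show ?thesis unfolding one_coaffinity_def by (rule bij_betw_same_card)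
qed

text \<open>For \<open>x \<noteq> y\<close> the points \<open>x\<close>, \<open>y\<close>,
  \<open>- (x + y)\<close> are distinct with sum 0, hence a line, and its image is a line by
  assumption. For \<open>x = y\<close> they coincide and exponent 3 suffices.\<close>

lemma AGL_if_one_coaffinity_0:
  fixes f :: "'k::{field,finite} ^ 'n \<Rightarrow> 'k ^ 'n"
  assumes k: "CARD('k) = 3" and b: "bij f" and 0: "one_coaffinity f = 0"
  shows "f \<in> AGL"
  unfolding AGL_iff_sum_eq_0[OF k]
proof (intro conjI allI)
  note s = exponent3_simps[OF exponent3_vec[OF k]]
  fix x y
  have good: "is_line (f ` L)" if "is_line L" for L
    using 0 that unfolding one_coaffinity_def by auto
  show "f x + f y + f (- (x + y)) = 0"
  proof (cases "x = y")
    case True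
    have "- (y + y) = y" by (simp only: s)
    then show ?thesis unfolding True by (simp only: exponent3_vec[OF k])
  next
    case False
    have "x \<noteq> - (x + y)"
    proof
      assume "x = - (x + y)"
      then have "x + x + y = 0" by (metis add.commute add_eq_0_iff group_cancel.add1)
      moreover have "x + x + y = y - x" by (simp only: s)
      ultimately show False using False by simp
    qed
    moreover have "y \<noteq> - (x + y)"
    proof
      assume "y = - (x + y)"
      then have "x + y + y = 0" by (metis ab_left_minus add.commute)
      moreover have "x + y + y = x - y" by (simp only: s)
      ultimately show False using False by simp
    qed
    ultimately have d: "x \<noteq> y" "x \<noteq> - (x + y)" "y \<noteq> - (x + y)" using False by auto
    have "is_line {x, y, - (x + y)}"
      unfolding is_line_iff_sum_eq_0[OF k d] by simp
    then have "is_line {f x, f y, f (- (x + y))}" using good by fastforce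
    then show ?thesis
      using is_line_iff_sum_eq_0[OF k, of "f x" "f y" "f (- (x + y))"] d bij_is_inj[OF b]
      by (auto simp: inj_eq)
  qed
qed (rule b)


section \<open>Coordinate frames and the lines of the plane\<close>

text \<open>Linear independence of a pair, stated by coefficients because the set
  \<open>{d, e}\<close> would hide the case \<open>d = e\<close>.\<close>

definition indep2 :: "'k::field ^ 'n \<Rightarrow> 'k ^ 'n \<Rightarrow> bool" where
  "indep2 d e \<longleftrightarrow> (\<forall>i j. i *s d + j *s e = 0 \<longrightarrow> i = 0 \<and> j = 0)"

definition pt :: "'k::field ^ 'n \<Rightarrow> 'k ^ 'n \<Rightarrow> 'k ^ 'n \<Rightarrow> 'k \<Rightarrow> 'k \<Rightarrow> 'k ^ 'n" where
  "pt c d e i j = c + i *s d + j *s e"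

lemma pt_eq_iff:
  assumes "indep2 d e"
  shows "pt c d e i j = pt c d e i' j' \<longleftrightarrow> i = i' \<and> j = j'"
proof
  assume "pt c d e i j = pt c d e i' j'"
  then have "(i - i') *s d + (j - j') *s e = 0"
    by (simp add: pt_def vector_sub_rdistrib algebra_simps)
  then show "i = i' \<and> j = j'" using assms unfolding indep2_def by fastforce
qed simp

text \<open>By counting: coordinate pairs inject into the plane, and both sets have the same
  size.\<close>

lemma pt_surj:
  fixes d e :: "'k::{field,finite} ^ 2"
  assumes "indep2 d e"
  shows "\<exists>i j. x = pt c d e i j"
proof -
  let ?g = "\<lambda>(i, j). pt c d e i j"
  have "inj ?g" using pt_eq_iff[OF assms] by (auto simp: inj_def)
  then have "card (range ?g) = CARD('k \<times> 'k)" by (rule card_image)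
  also have "\<dots> = CARD('k ^ 2)" by (simp add: CARD_vec power2_eq_square)
  finally have "range ?g = UNIV" by (intro card_subset_eq) auto
  then have "x \<in> range ?g" by simp
  then show ?thesis by auto
qed

lemma bij_pt:
  fixes d e :: "'k::{field,finite} ^ 2"
  assumes "indep2 d e"
  shows "bij (\<lambda>(i, j). pt c d e i j)"
  using pt_surj[OF assms, of _ c] pt_eq_iff[OF assms] by (auto simp: bij_def inj_def image_iff)

lemma pt_shift: "pt (pt c d e x y) d e i j = pt c d e (x + i) (y + j)"
  by (simp add: pt_def vector_sadd_rdistrib algebra_simps)

text \<open>Taking \<open>m *s d + e\<close> as second axis turns the lines of slope
  \<open>m\<close> into those of slope 0. The swapped variant below, with that vector as first axis,
  turns them into rows.\<close>

lemma pt_shear: "pt c d (m *s d + e) i j = pt c d e (i + m * j) j"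
  by (simp add: pt_def vector_sadd_rdistrib vector_add_ldistrib vector_smult_assoc algebra_simps)

lemma pt_shear_swap: "pt c (m *s d + e) d i j = pt c d e (m * i + j) i"
  by (simp add: pt_def vector_sadd_rdistrib vector_add_ldistrib vector_smult_assoc algebra_simps)

lemma indep2_shear:
  assumes "indep2 d e"
  shows "indep2 d (m *s d + e)" and "indep2 (m *s d + e) d"
proof -
  have i: "i = 0 \<and> j = 0" if "i *s d + j *s (m *s d + e) = 0" for i j
  proof -
    have "(i + j * m) *s d + j *s e = 0"
      using that by (simp add: vector_sadd_rdistrib vector_add_ldistrib vector_smult_assoc algebra_simps)
    then have "i + j * m = 0 \<and> j = 0" using assms unfolding indep2_def by blast
    then show ?thesis by auto
  qed
  then show "indep2 d (m *s d + e)" unfolding indep2_def by blast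
  show "indep2 (m *s d + e) d"
    unfolding indep2_def using i by (subst add.commute) blast
qed

text \<open>Besides the three horizontal lines, the lines are \<open>i = m * j + b\<close> in frame coordinates:
  the slope is measured against the second axis.\<close>

definition hline :: "'k::field ^ 'n \<Rightarrow> 'k ^ 'n \<Rightarrow> 'k ^ 'n \<Rightarrow> 'k \<Rightarrow> ('k ^ 'n) set" where
  "hline c d e j = range (\<lambda>i. pt c d e i j)"

definition sline :: "'k::field ^ 'n \<Rightarrow> 'k ^ 'n \<Rightarrow> 'k ^ 'n \<Rightarrow> 'k \<Rightarrow> 'k \<Rightarrow> ('k ^ 'n) set" where
  "sline c d e m b = range (\<lambda>j. pt c d e (m * j + b) j)"

lemma is_line_iff_hline_or_sline:
  fixes d e :: "'k::{field,finite} ^ 2"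
  assumes "indep2 d e"
  shows "is_line L \<longleftrightarrow> (\<exists>j. L = hline c d e j) \<or> (\<exists>m b. L = sline c d e m b)"
proof
  assume "is_line L"
  then obtain a v where v: "v \<noteq> 0" "L = range (\<lambda>s. a + s *s v)"
    unfolding is_line_iff_range by blast
  obtain i j where a: "a = pt c d e i j" using pt_surj[OF assms] by blast
  obtain x y where "v = pt 0 d e x y" using pt_surj[OF assms] by blast
  then have vxy: "v = x *s d + y *s e" by (simp add: pt_def)
  have L: "L = range (\<lambda>s. pt c d e (i + s * x) (j + s * y))"
    unfolding v(2) a vxy
    by (simp add: pt_def vector_sadd_rdistrib vector_add_ldistrib vector_smult_assoc algebra_simps)
  show "(\<exists>j. L = hline c d e j) \<or> (\<exists>m b. L = sline c d e m b)"
  proof (cases "y = 0")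
    case True
    then have "x \<noteq> 0" using v(1) vxy by auto
    then have "surj (\<lambda>s. i + s * x)"
      by (intro surjI[where f = "\<lambda>t. (t - i) / x"]) simp
    then have "range (\<lambda>t. pt c d e t j) = (\<lambda>t. pt c d e t j) ` range (\<lambda>s. i + s * x)" by simp
    also have "\<dots> = L" by (simp add: L True image_image)
    finally show ?thesis unfolding hline_def by blast
  next
    case False
    \<comment> \<open>Dividing the direction \<open>(x, y)\<close> by \<open>y\<close> makes its
      second coordinate 1, so its first becomes the slope; \<open>b\<close> is the first coordinate
      where the line meets row 0.\<close>
    define m b where "m = x / y" and "b = i - m * j"
    have "surj (\<lambda>s. j + s * y)"
      using False by (intro surjI[where f = "\<lambda>t. (t - j) / y"]) simp
    then have "sline c d e m b = (\<lambda>t. pt c d e (m * t + b) t) ` range (\<lambda>s. j + s * y)"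
      by (simp add: sline_def)
    also have "\<dots> = L"
    proof -
      have "m * (j + s * y) + b = i + s * x" for s
        using False by (simp add: m_def b_def field_simps)
      then show ?thesis by (simp add: L image_image)
    qed
    finally show ?thesis by blast
  qed
next
  have h: "is_line (hline c d e j)" for j
  proof -
    have "hline c d e j = range (\<lambda>s. (c + j *s e) + s *s d)"
      by (simp add: hline_def pt_def algebra_simps)
    moreover have "d \<noteq> 0"
      using assms unfolding indep2_def by (metis add_0 vector_smult_lzero vector_smult_rzero zero_neq_one)
    ultimately show ?thesis unfolding is_line_iff_range by blast
  qed
  have s: "is_line (sline c d e m b)" for m b
  proof -
    have "sline c d e m b = range (\<lambda>s. (c + b *s d) + s *s (m *s d + e))"
      by (simp add: sline_def pt_def vector_sadd_rdistrib vector_add_ldistrib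
          vector_smult_assoc algebra_simps)
    moreover have "m *s d + e \<noteq> 0"
      using assms unfolding indep2_def by (metis vector_smult_lid zero_neq_one)
    ultimately show ?thesis unfolding is_line_iff_range by blast
  qed
  assume "(\<exists>j. L = hline c d e j) \<or> (\<exists>m b. L = sline c d e m b)"
  then show "is_line L" using h s by blast
qed

lemma hline_inject:
  assumes "indep2 d e"
  shows "hline c d e j = hline c d e j' \<longleftrightarrow> j = j'"
proof
  assume "hline c d e j = hline c d e j'"
  then have "pt c d e 0 j \<in> hline c d e j'" by (auto simp: hline_def)
  then show "j = j'" by (auto simp: hline_def pt_eq_iff[OF assms])
qed simp

lemma sline_inject:
  assumes "indep2 d e"
  shows "sline c d e m b = sline c d e m' b' \<longleftrightarrow> m = m' \<and> b = b'"
proof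
  assume eq: "sline c d e m b = sline c d e m' b'"
  have t: "m * t + b = m' * t + b'" for t
  proof -
    have "pt c d e (m * t + b) t \<in> sline c d e m' b'"
      unfolding eq[symmetric] by (simp add: sline_def)
    then obtain j where "pt c d e (m * t + b) t = pt c d e (m' * j + b') j"
      unfolding sline_def by blast
    then show ?thesis by (auto simp: pt_eq_iff[OF assms])
  qed
  from t[of 0] t[of 1] show "m = m' \<and> b = b'" by simp
qed simp

lemma hline_neq_sline:
  assumes "indep2 d e"
  shows "hline c d e j \<noteq> sline c d e m b"
proof
  assume eq: "hline c d e j = sline c d e m b"
  \<comment> \<open>A sloped line meets every row; its point in row \<open>j + 1\<close> is not in
    row \<open>j\<close>.\<close>
  have "pt c d e (m * (j + 1) + b) (j + 1) \<in> hline c d e j"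
    unfolding eq sline_def by blast
  then show False by (auto simp: hline_def pt_eq_iff[OF assms])
qed

section \<open>Counting bad lines by their sums\<close>

definition row_sum :: "('k::field \<Rightarrow> 'k \<Rightarrow> 'v::ab_group_add) \<Rightarrow> 'k \<Rightarrow> 'v" where
  "row_sum w j = w 0 j + w 1 j + w (-1) j"

text \<open>The arguments are the coordinates of the points of \<open>sline\<close> with slope
  \<open>m\<close> and offset \<open>b\<close>, listed by second coordinate 0, 1, -1.\<close>

definition slope_sum :: "('k::field \<Rightarrow> 'k \<Rightarrow> 'v::ab_group_add) \<Rightarrow> 'k \<Rightarrow> 'k \<Rightarrow> 'v" where
  "slope_sum w m b = w b 0 + w (m + b) 1 + w (b - m) (-1)"

text \<open>Injectivity keeps the three image points of a line distinct, so the zero-sum criterion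
  decides whether the line is good. Rows and sloped lines list every line once, and the bad ones are
  counted direction by direction.\<close>

lemma one_coaffinity_eq_sums:
  fixes f :: "'k::{field,finite} ^ 2 \<Rightarrow> 'k ^ 2"
    and c d e :: "'k ^ 2"
  assumes k: "CARD('k) = 3" and f: "inj f" and ind: "indep2 d e"
  defines "w \<equiv> \<lambda>i j. f (pt c d e i j)"
  shows "one_coaffinity f =
    card {j. row_sum w j \<noteq> 0} + (\<Sum>m\<in>UNIV. card {b. slope_sum w m b \<noteq> 0})"
proof -
  note U = card3_field(1)[OF k]
  have ne: "(1::'k) \<noteq> -1" by (rule card3_field(3)[OF k])
  have w: "w i j = w i' j' \<longleftrightarrow> i = i' \<and> j = j'" for i j i' j'
    by (simp add: w_def inj_eq[OF f] pt_eq_iff[OF ind])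
  have h: "is_line (f ` hline c d e j) \<longleftrightarrow> row_sum w j = 0" for j
  proof -
    have "f ` hline c d e j = {w 0 j, w 1 j, w (-1) j}"
      by (simp add: hline_def U w_def)
    then show ?thesis
      unfolding row_sum_def using is_line_iff_sum_eq_0[OF k, of "w 0 j" "w 1 j" "w (-1) j"]
      using ne by (simp add: w)
  qed
  have s: "is_line (f ` sline c d e m b) \<longleftrightarrow> slope_sum w m b = 0" for m b
  proof -
    have "f ` sline c d e m b = {w b 0, w (m + b) 1, w (b - m) (-1)}"
      by (simp add: sline_def U w_def)
    then show ?thesis
      unfolding slope_sum_def
      using is_line_iff_sum_eq_0[OF k, of "w b 0" "w (m + b) 1" "w (b - m) (-1)"]
      using ne by (simp add: w)
  qed
  let ?H = "hline c d e ` {j. row_sum w j \<noteq> 0}"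
  let ?S = "(\<lambda>(m, b). sline c d e m b) ` (SIGMA m:UNIV. {b. slope_sum w m b \<noteq> 0})"
  have "{L. is_line L \<and> \<not> is_line (f ` L)} = ?H \<union> ?S"
  proof (intro equalityI subsetI)
    fix L assume "L \<in> {L. is_line L \<and> \<not> is_line (f ` L)}"
    then have L: "is_line L" "\<not> is_line (f ` L)" by auto
    from L(1) consider j where "L = hline c d e j" | m b where "L = sline c d e m b"
      unfolding is_line_iff_hline_or_sline[OF ind, of L c] by blast
    then show "L \<in> ?H \<union> ?S"
    proof cases
      case 1
      then show ?thesis using L(2) h by blast
    next
      case 2
      then have "(m, b) \<in> (SIGMA m:UNIV. {b. slope_sum w m b \<noteq> 0})" using L(2) s by simp
      then have "(\<lambda>(m, b). sline c d e m b) (m, b) \<in> ?S" by (rule imageI)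
      then show ?thesis using 2 by simp
    qed
  next
    fix L assume "L \<in> ?H \<union> ?S"
    then consider j where "L = hline c d e j" "row_sum w j \<noteq> 0"
      | m b where "L = sline c d e m b" "slope_sum w m b \<noteq> 0" by auto
    then show "L \<in> {L. is_line L \<and> \<not> is_line (f ` L)}"
      unfolding mem_Collect_eq is_line_iff_hline_or_sline[OF ind, of L c]
      by cases (simp_all only: h s, blast+)
  qed
  then have "one_coaffinity f = card (?H \<union> ?S)" by (simp add: one_coaffinity_def)
  also have "\<dots> = card ?H + card ?S"
    by (rule card_Un_disjoint) (auto simp: hline_neq_sline[OF ind])
  also have "card ?H = card {j. row_sum w j \<noteq> 0}"
    by (intro card_image inj_onI) (simp add: hline_inject[OF ind])
  also have "card ?S = card (SIGMA m:UNIV. {b. slope_sum w m b \<noteq> 0})"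
    by (intro card_image inj_onI) (auto simp: sline_inject[OF ind])
  also have "\<dots> = (\<Sum>m\<in>UNIV. card {b. slope_sum w m b \<noteq> 0})"
    by (rule card_SigmaI) auto
  finally show ?thesis .
qed


section \<open>Linear relations among the line sums\<close>

lemma sum_UNIV_card3:
  assumes "CARD('k::{field,finite}) = 3"
  shows "(\<Sum>x\<in>UNIV. g (x::'k)) = g 0 + (g 1 + g (-1))"
  using card3_field(3)[OF assms] by (simp add: card3_field(1)[OF assms])

lemma card_Collect_card3:
  assumes "CARD('k::{field,finite}) = 3"
  shows "card {x::'k. Q x} = (if Q 0 then 1 else 0) + ((if Q 1 then 1 else 0) + (if Q (-1) then 1 else 0))"
proof -
  have "card {x::'k. Q x} = (\<Sum>x\<in>UNIV. if Q x then 1 else 0)"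
    by (simp add: sum.If_cases)
  then show ?thesis by (simp only: sum_UNIV_card3[OF assms])
qed

lemma all_card3:
  assumes "CARD('k::{field,finite}) = 3"
  shows "(\<forall>x::'k. Q x) \<longleftrightarrow> Q 0 \<and> Q 1 \<and> Q (-1)"
proof -
  have "x = 0 \<or> x = 1 \<or> x = -1" for x :: 'k
    using card3_field(1)[OF assms] by auto
  then show ?thesis by metis
qed

lemma two_eq_minus_one:
  assumes "CARD('k::{field,finite}) = 3"
  shows "(2::'k) = -1"
  using card3_field(2)[OF assms] by simp

text \<open>The bijection only permutes the summands of the sum of all vectors. Negation permutes
  them too, so this sum is its own negative; its double and its triple vanish, hence it is
  0.\<close>

lemma sum_UNIV_bij_eq_0:
  fixes f :: "'k::{field,finite} ^ 'n \<Rightarrow> 'k ^ 'n"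
  assumes k: "CARD('k) = 3" and "bij f"
  shows "sum f UNIV = 0"
proof -
  let ?T = "\<Sum>x\<in>UNIV. x :: 'k ^ 'n"
  have T: "sum f UNIV = ?T" using assms(2) by (rule sum.reindex_bij_betw)
  have "bij (uminus :: 'k ^ 'n \<Rightarrow> _)" by (rule o_bij[where g = uminus]) auto
  then have "(\<Sum>x\<in>UNIV. - x) = ?T" by (rule sum.reindex_bij_betw)
  then have "?T = - ?T" by (simp add: sum_negf)
  then have "?T + ?T = 0" by (simp only: eq_neg_iff_add_eq_0)
  then show ?thesis using exponent3_vec[OF k, of ?T] T by simp
qed

lemma frame_total:
  fixes f :: "'k::{field,finite} ^ 2 \<Rightarrow> 'k ^ 2"
  assumes k: "CARD('k) = 3" and f: "bij f" and ind: "indep2 d e"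
  shows "(\<Sum>i\<in>UNIV. \<Sum>j\<in>UNIV. f (pt c d e i j)) = 0"
proof -
  have "bij (\<lambda>(i, j). pt c d e i j)" by (rule bij_pt[OF ind])
  then have "(\<Sum>p\<in>UNIV. f (case p of (i, j) \<Rightarrow> pt c d e i j)) = sum f UNIV"
    by (rule sum.reindex_bij_betw)
  then show ?thesis
    using sum_UNIV_bij_eq_0[OF k f]
    by (simp add: sum.cartesian_product case_prod_unfold)
qed

context
  fixes w :: "'k::{field,finite} \<Rightarrow> 'k \<Rightarrow> 'v::ab_group_add"
  assumes k: "CARD('k) = 3"
begin

lemma row_sums_total:
  assumes "(\<Sum>i\<in>UNIV. \<Sum>j\<in>UNIV. w i j) = 0"
  shows "row_sum w 0 + row_sum w 1 + row_sum w (-1) = 0"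
  using assms unfolding sum_UNIV_card3[OF k] row_sum_def by (simp only: add_ac)

text \<open>The three lines of one slope partition the plane; this is checked for each of the three
  slopes.\<close>

lemma slope_sums_total:
  assumes "(\<Sum>i\<in>UNIV. \<Sum>j\<in>UNIV. w i j) = 0"
  shows "slope_sum w m 0 + slope_sum w m 1 + slope_sum w m (-1) = 0"
proof -
  have "\<forall>m. slope_sum w m 0 + slope_sum w m 1 + slope_sum w m (-1) = (\<Sum>i\<in>UNIV. \<Sum>j\<in>UNIV. w i j)"
    unfolding all_card3[OF k] sum_UNIV_card3[OF k] slope_sum_def
    by (simp add: two_eq_minus_one[OF k] add_ac)
  then show ?thesis using assms by simp
qed

text \<open>The four lines through a point cover it four times and every other point once.\<close>

lemma point_sums_total:
  assumes exp3: "\<And>z::'v. z + z + z = 0" and "(\<Sum>i\<in>UNIV. \<Sum>j\<in>UNIV. w i j) = 0"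
  shows "row_sum w y + slope_sum w 0 x + slope_sum w 1 (x - y) + slope_sum w (-1) (x + y) = 0"
proof -
  have "\<forall>x y. row_sum w y + slope_sum w 0 x + slope_sum w 1 (x - y) + slope_sum w (-1) (x + y)
     = (\<Sum>i\<in>UNIV. \<Sum>j\<in>UNIV. w i j) + (w x y + w x y + w x y)"
    unfolding all_card3[OF k] sum_UNIV_card3[OF k] slope_sum_def row_sum_def
    by (simp add: two_eq_minus_one[OF k] add_ac)
  then show ?thesis using assms exp3 by simp
qed

end

text \<open>In the next two lemmas the nine points of the plane are listed row by row as
  \<open>A, a, b\<close>, then \<open>e, p, r\<close>, then \<open>g, s, q\<close>, in the column order \<open>0, 1, -1\<close>.\<close>

lemma two_full_directions:
  fixes A a b e p r g s q :: "'v::ab_group_add"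
  assumes exp3: "\<And>z::'v. z + z + z = 0"
    and dist: "distinct [A, a, b, e, p, r, g, s, q]" and all: "\<And>z. z \<in> {A, a, b, e, p, r, g, s, q}"
    and rows: "A + a + b = 0" "e + p + r = 0" "g + s + q = 0"
    and cols: "A + e + g = 0" "a + p + s = 0" "b + r + q = 0"
  shows "A + p + q = 0 \<and> a + r + g = 0 \<and> b + e + s = 0 \<and>
    A + r + s = 0 \<and> a + e + q = 0 \<and> b + p + g = 0"
proof -
  note x = exponent3_simps[OF exp3]
  have b: "b = - (A + a)" and r: "r = - (e + p)" and g: "g = - (A + e)"
    and s: "s = - (a + p)" using rows cols by (metis add_eq_0_iff)+
  have "q = - (b + r)" using cols by (metis add_eq_0_iff)
  then have q: "q = A + a + e + p" unfolding b r by (simp only: x)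
  \<comment> \<open>By the parallelogram rule, \<open>T\<close> is the value that an affine map
    would take at the position of \<open>p\<close>. Its difference from each of the other eight
    values is a difference of two distinct listed values, so \<open>T\<close> must be
    \<open>p\<close>.\<close>
  define T where "T = a + e - A"
  have "T - A = a - g" "T - a = e - A" "T - b = e - a" "T - e = a - A" "T - g = a - e"
    "T - r = g - s" "T - s = b - r" "T - q = A - p"
    unfolding T_def g b r s q by (simp_all only: x)
  then have "T \<noteq> A" "T \<noteq> a" "T \<noteq> b" "T \<noteq> e" "T \<noteq> g" "T \<noteq> r" "T \<noteq> s" "T \<noteq> q"
    using dist by auto
  then have p: "p = a + e - A" using all[of T] T_def by auto
  show ?thesis unfolding q b r g s p by (simp only: x simp_thms)
qed

lemma full_direction_and_pencil:
  fixes A a b e p r g s q :: "'v::ab_group_add"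
  assumes exp3: "\<And>z::'v. z + z + z = 0"
    and dist: "distinct [A, a, b, e, p, r, g, s, q]" and all: "\<And>z. z \<in> {A, a, b, e, p, r, g, s, q}"
    and rows: "A + a + b = 0" "e + p + r = 0" "g + s + q = 0"
    and pencil: "A + e + g = 0" "A + p + q = 0" "A + r + s = 0"
  shows "(a + p + s = 0 \<and> b + r + q = 0 \<and> a + r + g = 0 \<and> b + e + s = 0 \<and> a + e + q = 0 \<and> b + p + g = 0)
    \<or> (b + p + s = 0 \<and> a + r + q = 0 \<and> b + r + g = 0 \<and> a + e + s = 0 \<and> b + e + q = 0 \<and> a + p + g = 0)"
proof -
  note x = exponent3_simps[OF exp3]
  have b: "b = - (A + a)" and r: "r = - (e + p)" and g: "g = - (A + e)"
    and q: "q = - (A + p)" using rows pencil by (metis add_eq_0_iff)+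
  have "s = - (A + r)" using pencil by (metis add_eq_0_iff)
  then have s: "s = e + p - A" unfolding r by (simp only: x)
  \<comment> \<open>By the parallelogram rule, \<open>T\<close> is the value that an affine map
    would take at the position of \<open>a\<close>. Differences as before exclude all values but
    \<open>a\<close> and \<open>b\<close>: the first case is the affine one, the second has
    \<open>a\<close> and \<open>b\<close> interchanged.\<close>
  define T where "T = p - e + A"
  have "T - A = p - e" "T - e = p - g" "T - g = p - A" "T - p = A - e" "T - q = g - p"
    "T - r = A - p" "T - s = e - A"
    unfolding T_def g b r s q by (simp_all only: x)
  then have "T \<noteq> A" "T \<noteq> e" "T \<noteq> g" "T \<noteq> p" "T \<noteq> q" "T \<noteq> r" "T \<noteq> s"
    using dist by auto
  then have "T = a \<or> T = b" using all[of T] by auto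
  then show ?thesis
  proof
    assume "T = a"
    then have a: "a = p - e + A" by (simp add: T_def)
    show ?thesis unfolding b r g q s a by (rule disjI1) (simp only: x simp_thms)
  next
    assume "T = b"
    then have bT: "b = p - e + A" by (simp add: T_def)
    have "a = - (A + b)" unfolding b by (simp only: x)
    then have a: "a = A + e - p" unfolding bT by (simp only: x)
    show ?thesis unfolding bT r g q s a by (rule disjI2) (simp only: x simp_thms)
  qed
qed


section \<open>Bijections with a full direction\<close>

text \<open>Injectivity and surjectivity of \<open>f\<close> supply the hypotheses
  \<open>dist\<close> and \<open>all\<close> of the two preceding lemmas.\<close>

lemma nine_values:
  fixes f :: "'k::{field,finite} ^ 2 \<Rightarrow> 'k ^ 2"
    and c d e :: "'k ^ 2"
  assumes k: "CARD('k) = 3" and f: "bij f" and ind: "indep2 d e"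
    and w_eq: "\<And>i j. w i j = f (pt c d e i j)"
  shows "distinct [w 0 0, w 1 0, w (-1) 0, w 0 1, w 1 1, w (-1) 1, w 0 (-1), w 1 (-1), w (-1) (-1)]"
    and "z \<in> {w 0 0, w 1 0, w (-1) 0, w 0 1, w 1 1, w (-1) 1, w 0 (-1), w 1 (-1), w (-1) (-1)}"
      (is "z \<in> ?W")
proof -
  note ne = card3_field(3)[OF k]
  have w: "w i j = w i' j' \<longleftrightarrow> i = i' \<and> j = j'" for i j i' j'
    by (simp add: w_eq inj_eq[OF bij_is_inj[OF f]] pt_eq_iff[OF ind])
  show "distinct [w 0 0, w 1 0, w (-1) 0, w 0 1, w 1 1, w (-1) 1, w 0 (-1), w 1 (-1), w (-1) (-1)]"
    using ne ne[symmetric] by (simp add: w)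
  obtain i j where "z = w i j"
    using pt_surj[OF ind] bij_is_surj[OF f] unfolding w_eq by (metis surjD)
  moreover have "\<forall>i j. w i j \<in> ?W" unfolding all_card3[OF k] by simp
  ultimately show "z \<in> ?W" by blast
qed

text \<open>\<open>two_full_directions\<close> provides zero sums for the six lines of slopes 1 and
  -1, so no line is bad.\<close>

lemma AGL_if_two_full_directions:
  fixes f :: "'k::{field,finite} ^ 2 \<Rightarrow> 'k ^ 2"
    and c d e :: "'k ^ 2"
  assumes k: "CARD('k) = 3" and f: "bij f" and ind: "indep2 d e"
  defines "w \<equiv> \<lambda>i j. f (pt c d e i j)"
  assumes rows: "\<And>j. row_sum w j = 0" and cols: "\<And>b. slope_sum w 0 b = 0"
  shows "f \<in> AGL"
proof -
  have w: "w i j = f (pt c d e i j)" for i j by (simp add: w_def)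
  note N = nine_values[OF k f ind w]
  have "\<forall>m b. slope_sum w m b = 0"
    using two_full_directions[OF exponent3_vec[OF k] N] rows[of 0] rows[of 1] rows[of "-1"]
      cols[of 0] cols[of 1] cols[of "-1"]
    unfolding all_card3[OF k] row_sum_def slope_sum_def
    by (simp add: two_eq_minus_one[OF k] add_ac)
  then have "one_coaffinity f = 0"
    using one_coaffinity_eq_sums[OF k bij_is_inj[OF f] ind, of c] rows unfolding w_def by simp
  then show ?thesis by (rule AGL_if_one_coaffinity_0[OF k f])
qed

text \<open>The lines of offset 0 are the sloped lines through the origin of the frame. Swapping the
  other two points of its row interchanges \<open>a\<close> and \<open>b\<close> in
  \<open>full_direction_and_pencil\<close>, so in each alternative \<open>f\<close> or the swapped
  map has no bad line.\<close>

lemma AGL_transpose_if_full_direction_and_pencil: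
  fixes f :: "'k::{field,finite} ^ 2 \<Rightarrow> 'k ^ 2"
    and c d e :: "'k ^ 2"
  assumes k: "CARD('k) = 3" and f: "bij f" and ind: "indep2 d e"
  defines "w \<equiv> \<lambda>i j. f (pt c d e i j)"
  assumes rows: "\<And>j. row_sum w j = 0" and pencil: "\<And>m. slope_sum w m 0 = 0"
  shows "f \<in> AGL \<or> f \<circ> Transposition.transpose (pt c d e 1 0) (pt c d e (-1) 0) \<in> AGL"
proof -
  have w: "w i j = f (pt c d e i j)" for i j by (simp add: w_def)
  note N = nine_values[OF k f ind w]
  let ?f = "f \<circ> Transposition.transpose (pt c d e 1 0) (pt c d e (-1) 0)"
  define w' where "w' = (\<lambda>i j. ?f (pt c d e i j))"
  \<comment> \<open>In coordinates the transposition negates the first coordinate on row 0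
    only.\<close>
  have w': "w' i j = w (if j = 0 then - i else i) j" for i j
  proof -
    have "\<forall>i. w' i j = w (if j = 0 then - i else i) j"
      unfolding all_card3[OF k] w'_def w_def using card3_field(3)[OF k]
      by (auto simp: Transposition.transpose_def pt_eq_iff[OF ind])
    then show ?thesis by blast
  qed
  have rows': "\<forall>j. row_sum w' j = 0"
    using rows[of 0] rows[of 1] rows[of "-1"] unfolding all_card3[OF k] row_sum_def w'
    by (simp add: add_ac)
  have "(\<forall>m b. slope_sum w m b = 0) \<or> (\<forall>m b. slope_sum w' m b = 0)"
    using full_direction_and_pencil[OF exponent3_vec[OF k] N] rows[of 0] rows[of 1] rows[of "-1"]
      pencil[of 0] pencil[of 1] pencil[of "-1"]
    unfolding all_card3[OF k] row_sum_def slope_sum_def w'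
    by (simp add: two_eq_minus_one[OF k] add_ac)
  then have "one_coaffinity f = 0 \<or> one_coaffinity ?f = 0"
  proof
    assume "\<forall>m b. slope_sum w m b = 0"
    then show ?thesis
      using one_coaffinity_eq_sums[OF k bij_is_inj[OF f] ind, of c] rows unfolding w_def by simp
  next
    have i: "inj ?f" using f by (simp add: bij_is_inj inj_compose)
    assume "\<forall>m b. slope_sum w' m b = 0"
    then have "one_coaffinity ?f = 0"
      using one_coaffinity_eq_sums[OF k i ind, of c] rows' unfolding w'_def[symmetric] by simp
    then show ?thesis ..
  qed
  moreover have "bij ?f" using f by (simp add: bij_comp)
  ultimately show ?thesis using AGL_if_one_coaffinity_0[OF k] f by blast
qed

text \<open>Translations permute the field; hence moving the origin or shearing the frame only
  relabels line sums.\<close>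

lemma sum_shift_card3:
  fixes u :: "'k::{field,finite} \<Rightarrow> 'v::ab_group_add"
  assumes k: "CARD('k) = 3"
  shows "u x + u (x + 1) + u (x - 1) = u 0 + u 1 + u (-1)"
proof -
  have "\<forall>x. u x + u (x + 1) + u (x - 1) = u 0 + u 1 + u (-1)"
    unfolding all_card3[OF k] by (simp add: two_eq_minus_one[OF k] add_ac)
  then show ?thesis by blast
qed

text \<open>A second full direction makes \<open>f\<close> affine. Otherwise each of the three
  slopes has at least two bad lines, and the bound 6 forces exactly two in each, leaving one good
  line per slope.\<close>

lemma full_direction_cases:
  fixes f :: "'k::{field,finite} ^ 2 \<Rightarrow> 'k ^ 2"
    and c d e :: "'k ^ 2"
  assumes k: "CARD('k) = 3" and f: "bij f" and ind: "indep2 d e"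
  defines "w \<equiv> \<lambda>i j. f (pt c d e i j)"
  assumes rows: "\<And>j. row_sum w j = 0" and le: "one_coaffinity f \<le> 6"
  shows "f \<in> AGL \<or>
    (one_coaffinity f = 6 \<and> (\<exists>a b. a \<noteq> b \<and> f \<circ> Transposition.transpose a b \<in> AGL))"
proof (cases "\<exists>m. \<forall>b. slope_sum w m b = 0")
  case True
  then obtain m where m: "\<And>b. slope_sum w m b = 0" by blast
  \<comment> \<open>The shear keeps the rows and makes the full slope \<open>m\<close> the slope 0
    of the new frame.\<close>
  let ?w = "\<lambda>i j. f (pt c d (m *s d + e) i j)"
  have w': "?w i j = w (i + m * j) j" for i j by (simp add: pt_shear w_def)
  have "row_sum ?w j = row_sum w j" for j
    using sum_shift_card3[OF k, of "\<lambda>i. w i j" "m * j"]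
    unfolding row_sum_def w' by (simp add: add_ac)
  moreover have "slope_sum ?w 0 b = slope_sum w m b" for b
    unfolding slope_sum_def w' by (simp add: add_ac)
  ultimately have "f \<in> AGL"
    using AGL_if_two_full_directions[OF k f indep2_shear(1)[OF ind, of m], of c] rows m by simp
  then show ?thesis ..
next
  case False
  have tot: "(\<Sum>i\<in>UNIV. \<Sum>j\<in>UNIV. w i j) = 0"
    unfolding w_def by (rule frame_total[OF k f ind])
  \<comment> \<open>Three sums with total 0 that do not all vanish include at least two nonzero
    ones.\<close>
  have card: "card {b. slope_sum w m b \<noteq> 0} \<ge> 2 \<and>
      (card {b. slope_sum w m b \<noteq> 0} = 2 \<longrightarrow> (\<exists>b. slope_sum w m b = 0))" for m
  proof -
    have "\<not> (slope_sum w m 0 = 0 \<and> slope_sum w m 1 = 0 \<and> slope_sum w m (-1) = 0)"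
      using False all_card3[OF k, of "\<lambda>b. slope_sum w m b = 0"] by blast
    then show ?thesis
      using slope_sums_total[OF k tot, of m] unfolding card_Collect_card3[OF k] by auto
  qed
  have co: "one_coaffinity f = card {b. slope_sum w 0 b \<noteq> 0}
     + (card {b. slope_sum w 1 b \<noteq> 0} + card {b. slope_sum w (-1) b \<noteq> 0})"
    using one_coaffinity_eq_sums[OF k bij_is_inj[OF f] ind, of c] rows
    unfolding w_def[symmetric] sum_UNIV_card3[OF k] by simp
  then have eq6: "one_coaffinity f = 6" and c0: "card {b. slope_sum w 0 b \<noteq> 0} = 2"
    and c1: "card {b. slope_sum w 1 b \<noteq> 0} = 2"
    using le card[of 0] card[of 1] card[of "-1"] by linarith+
  obtain x b where x: "slope_sum w 0 x = 0" and b: "slope_sum w 1 b = 0"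
    using card c0 c1 by blast
  \<comment> \<open>The good lines of slopes 0 and 1 meet in \<open>(x, y)\<close>, so the third good line passes through it.\<close>
  define y where "y = x - b"
  have y: "slope_sum w 1 (x - y) = 0" using b by (simp add: y_def)
  have z: "slope_sum w (-1) (x + y) = 0"
    using point_sums_total[OF k exponent3_vec[OF k] tot, of y x] rows x y by simp
  \<comment> \<open>The common point of the good lines becomes the origin, so that they get offset
    0.\<close>
  let ?c = "pt c d e x y"
  let ?w = "\<lambda>i j. f (pt ?c d e i j)"
  have w': "?w i j = w (x + i) (y + j)" for i j by (simp add: pt_shift w_def)
  have "row_sum ?w j = row_sum w (y + j)" for j
    using sum_shift_card3[OF k, of "\<lambda>i. w i (y + j)" x]
    by (simp add: row_sum_def w')
  moreover have "\<forall>m. slope_sum ?w m 0 = 0"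
  proof -
    \<comment> \<open>The line of slope \<open>m\<close> through \<open>(x, y)\<close> has offset
      \<open>x - m * y\<close>; shifting its parameter by \<open>y\<close> aligns the two
      sums.\<close>
    have "slope_sum ?w m 0 = slope_sum w m (x - m * y)" for m
      using sum_shift_card3[OF k, of "\<lambda>j. w (x + m * (j - y)) j" y]
      by (simp add: slope_sum_def w' algebra_simps)
    then show ?thesis unfolding all_card3[OF k] using x y z by simp
  qed
  ultimately have "f \<in> AGL \<or> f \<circ> Transposition.transpose (pt ?c d e 1 0) (pt ?c d e (-1) 0) \<in> AGL"
    using rows by (intro AGL_transpose_if_full_direction_and_pencil[OF k f ind]) simp_all
  moreover have "pt ?c d e 1 0 \<noteq> pt ?c d e (-1) 0"
    using card3_field(3)[OF k] by (simp add: pt_eq_iff[OF ind])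
  ultimately show ?thesis using eq6 by blast
qed

section \<open>Reduction to a full row direction\<close>

text \<open>The multiples of \<open>d\<close> are at most three of the nine vectors, and any other
  vector serves as \<open>e\<close>.\<close>

lemma exists_indep2:
  fixes d :: "'k::{field,finite} ^ 2"
  assumes k: "CARD('k) = 3" and d: "d \<noteq> 0"
  obtains e where "indep2 d e"
proof -
  have "card (range (\<lambda>s. s *s d)) \<le> 3" using card_image_le[of UNIV "\<lambda>s. s *s d"] k by simp
  moreover have "CARD('k ^ 2) = 9" by (simp add: CARD_vec k)
  ultimately have "range (\<lambda>s. s *s d) \<noteq> UNIV" by auto
  then obtain e where e: "e \<notin> range (\<lambda>s. s *s d)" by blast
  have "i = 0 \<and> j = 0" if ij: "i *s d + j *s e = 0" for i j
  proof -
    have "j = 0"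
    proof (rule ccontr)
      assume j: "j \<noteq> 0"
      have "j *s e = - i *s d" using ij by (simp add: vector_smult_lneg eq_neg_iff_add_eq_0 add.commute)
      then have "(1 / j) *s (j *s e) = (1 / j) *s (- i *s d)" by simp
      then have "e = (- i / j) *s d" using j by (simp add: vector_smult_assoc)
      then show False using e by blast
    qed
    then show ?thesis using ij d by simp
  qed
  then show ?thesis using that unfolding indep2_def by blast
qed

text \<open>A direction that is not full has at least two bad lines, so four such directions would
  give at least eight. Hence some direction is full, and a change of frame makes it the row
  direction.\<close>

lemma AGL_or_transpose_if_one_coaffinity_le_6:
  fixes f :: "'k::{field,finite} ^ 2 \<Rightarrow> 'k ^ 2"
  assumes k: "CARD('k) = 3" and f: "bij f" and le: "one_coaffinity f \<le> 6"
  shows "f \<in> AGL \<or>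
    (one_coaffinity f = 6 \<and> (\<exists>a b. a \<noteq> b \<and> f \<circ> Transposition.transpose a b \<in> AGL))"
proof -
  have "(vec 1 :: 'k ^ 2) \<noteq> 0" by (simp add: vec_eq_iff)
  then obtain d e :: "'k ^ 2" where ind: "indep2 d e" using exists_indep2[OF k] by blast
  define w where "w = (\<lambda>i j. f (pt 0 d e i j))"
  have tot: "(\<Sum>i\<in>UNIV. \<Sum>j\<in>UNIV. w i j) = 0"
    unfolding w_def by (rule frame_total[OF k f ind])
  have r2: "card {j. row_sum w j \<noteq> 0} \<ge> 2" if "\<not> (\<forall>j. row_sum w j = 0)"
    using that row_sums_total[OF k tot] unfolding card_Collect_card3[OF k] all_card3[OF k] by auto
  have s2: "card {b. slope_sum w m b \<noteq> 0} \<ge> 2" if "\<not> (\<forall>b. slope_sum w m b = 0)" for m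
    using that slope_sums_total[OF k tot, of m]
    unfolding card_Collect_card3[OF k] all_card3[OF k] by auto
  have "(\<forall>j. row_sum w j = 0) \<or> (\<exists>m. \<forall>b. slope_sum w m b = 0)"
  proof (rule ccontr)
    assume "\<not> ?thesis"
    then have "card {j. row_sum w j \<noteq> 0} \<ge> 2" and s3: "\<And>m. card {b. slope_sum w m b \<noteq> 0} \<ge> 2"
      using r2 s2 by blast+
    then show False
      using one_coaffinity_eq_sums[OF k bij_is_inj[OF f] ind, of 0] le
      unfolding w_def[symmetric] sum_UNIV_card3[OF k]
      using s3[of 0] s3[of 1] s3[of "-1"] by linarith
  qed
  then show ?thesis
  proof (elim disjE exE)
    assume "\<forall>j. row_sum w j = 0"
    then show ?thesis using full_direction_cases[OF k f ind _ le, of 0] unfolding w_def by blast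
  next
    fix m assume m: "\<forall>b. slope_sum w m b = 0"
    \<comment> \<open>With the axes swapped after the shear, the full slope \<open>m\<close> becomes
      the row direction.\<close>
    let ?w = "\<lambda>i j. f (pt 0 (m *s d + e) d i j)"
    have "row_sum ?w j = slope_sum w m j" for j
      by (simp add: row_sum_def slope_sum_def w_def pt_shear_swap)
    then show ?thesis
      using full_direction_cases[OF k f indep2_shear(2)[OF ind, of m] _ le, of 0] m by simp
  qed
qed

section \<open>Transpositions and the affine group\<close>

text \<open>The origin is \<open>- (a + b)\<close>, the third point of the line through
  \<open>a\<close> and \<open>b\<close>; the first axis runs from there to \<open>a\<close>.\<close>

lemma frame_through_pair:
  fixes a b :: "'k::{field,finite} ^ 2"
  assumes k: "CARD('k) = 3" and "a \<noteq> b"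
  obtains c d e where "indep2 d e" "pt c d e 1 0 = a" "pt c d e (-1) 0 = b"
proof -
  note s = exponent3_simps[OF exponent3_vec[OF k]]
  have "a + (a + b) = b - a" by (simp only: s)
  then have "a + (a + b) \<noteq> 0" using assms(2) by (metis right_minus_eq)
  then obtain e where "indep2 (a + (a + b)) e" using exists_indep2[OF k] by blast
  moreover have "pt (- (a + b)) (a + (a + b)) e 1 0 = a" by (simp add: pt_def)
  moreover have "- (a + b) - (a + (a + b)) = b" by (simp only: s)
  then have "pt (- (a + b)) (a + (a + b)) e (-1) 0 = b"
    by (simp add: pt_def vector_smult_lneg)
  ultimately show ?thesis using that by blast
qed

lemma row_sum_pt:
  fixes d e :: "'k::{field,finite} ^ 2"
  assumes k: "CARD('k) = 3"
  shows "row_sum (pt c d e) j = 0"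
  unfolding row_sum_def pt_def vector_smult_lneg vector_smult_lzero vector_smult_lid
  by (simp only: exponent3_simps[OF exponent3_vec[OF k]])

lemma slope_sum_pt:
  fixes d e :: "'k::{field,finite} ^ 2"
  assumes k: "CARD('k) = 3"
  shows "slope_sum (pt c d e) m b = 0"
  unfolding slope_sum_def pt_def vector_smult_lneg vector_smult_lzero vector_smult_lid
    vector_sadd_rdistrib vector_sub_rdistrib
  by (simp only: exponent3_simps[OF exponent3_vec[OF k]])

text \<open>Match points with equal coordinates in frames through the two pairs. The result has zero
  line sums, since \<open>pt\<close> does, so it is affine without computing a matrix.\<close>

lemma AGL_two_transitive:
  fixes a b :: "'k::{field,finite} ^ 2"
  assumes k: "CARD('k) = 3" and "a \<noteq> b" and "a' \<noteq> b'"
  obtains \<gamma> where "\<gamma> \<in> AGL" "\<gamma> a = a'" "\<gamma> b = b'"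
proof -
  obtain c d e where F: "indep2 d e" "pt c d e 1 0 = a" "pt c d e (-1) 0 = b"
    using frame_through_pair[OF k assms(2)] .
  obtain c' d' e' where F': "indep2 d' e'" "pt c' d' e' 1 0 = a'" "pt c' d' e' (-1) 0 = b'"
    using frame_through_pair[OF k assms(3)] .
  let ?g = "\<lambda>(i, j). pt c d e i j" and ?g' = "\<lambda>(i, j). pt c' d' e' i j"
  define \<gamma> where "\<gamma> = ?g' \<circ> inv ?g"
  have g: "bij ?g" "bij ?g'" by (rule bij_pt[OF F(1)], rule bij_pt[OF F'(1)])
  then have b: "bij \<gamma>" unfolding \<gamma>_def by (intro bij_comp bij_imp_bij_inv)
  have eq: "\<gamma> (pt c d e i j) = pt c' d' e' i j" for i j
    using inv_f_f[OF bij_is_inj[OF g(1)], of "(i, j)"] by (simp add: \<gamma>_def)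
  have "one_coaffinity \<gamma> = 0"
    using one_coaffinity_eq_sums[OF k bij_is_inj[OF b] F(1), of c]
    by (simp add: eq row_sum_pt[OF k] slope_sum_pt[OF k])
  then have "\<gamma> \<in> AGL" by (rule AGL_if_one_coaffinity_0[OF k b])
  then show ?thesis using that eq F F' by metis
qed

text \<open>In a frame through \<open>a\<close> and \<open>b\<close>, the transposition maps row 0
  to itself and fixes the other rows pointwise, so all rows stay good. A sloped line stays good
  exactly when it meets row 0 in the fixed origin, leaving two bad lines for each of the three
  slopes.\<close>

lemma one_coaffinity_transpose:
  fixes a b :: "'k::{field,finite} ^ 2"
  assumes k: "CARD('k) = 3" and "a \<noteq> b"
  shows "one_coaffinity (Transposition.transpose a b) = 6"
proof -
  note s = exponent3_simps[OF exponent3_vec[OF k]]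
  note ne = card3_field(3)[OF k]
  obtain c d e where F: "indep2 d e" "pt c d e 1 0 = a" "pt c d e (-1) 0 = b"
    using frame_through_pair[OF k assms(2)] .
  define w where "w = (\<lambda>i j. Transposition.transpose a b (pt c d e i j))"
  have w: "w i j = pt c d e (if j = 0 then - i else i) j" for i j
  proof -
    have "\<forall>i. w i j = pt c d e (if j = 0 then - i else i) j"
      unfolding all_card3[OF k] w_def F(2,3)[symmetric] using ne
      by (auto simp: Transposition.transpose_def pt_eq_iff[OF F(1)])
    then show ?thesis by blast
  qed
  have "row_sum w j = row_sum (pt c d e) j" for j
    by (simp add: row_sum_def w add_ac)
  then have r: "row_sum w j = 0" for j by (simp add: row_sum_pt[OF k])
  \<comment> \<open>The swap replaces \<open>x\<close> by \<open>- x\<close> in row 0, changing the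
    zero sum by minus twice \<open>x *s d\<close>, which is \<open>x *s d\<close> in exponent
    3.\<close>
  have "slope_sum w m x = x *s d" for m x
  proof -
    have "slope_sum w m x = pt c d e (- x) 0 + pt c d e (m + x) 1 + pt c d e (x - m) (-1)"
      by (simp add: slope_sum_def w)
    also have "\<dots> = x *s d"
      unfolding pt_def vector_smult_lneg vector_smult_lzero vector_smult_lid
        vector_sadd_rdistrib vector_sub_rdistrib
      by (simp only: s)
    finally show ?thesis .
  qed
  moreover have "d \<noteq> 0" using F assms(2) by (auto simp: pt_def)
  ultimately have "slope_sum w m x = 0 \<longleftrightarrow> x = 0" for m x by simp
  then have "card {x. slope_sum w m x \<noteq> 0} = 2" for m
    unfolding card_Collect_card3[OF k] by simp
  then show ?thesis
    using one_coaffinity_eq_sums[OF k inj_transpose[of a b] F(1), of c] r k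
    unfolding w_def[symmetric] by simp
qed

theorem theorem8p2:
  fixes f :: "'k::{field,finite} ^ 2 \<Rightarrow> 'k ^ 2"
  assumes "CARD('k) = 3"
    and "bij f"
    and "f \<notin> AGL"
  shows "one_coaffinity f \<ge> 6 \<and>
    (\<forall>\<tau> :: 'k ^ 2 \<Rightarrow> 'k ^ 2. is_transposition \<tau> \<longrightarrow>
      (one_coaffinity f = 6 \<longleftrightarrow> f \<in> AGL_double_coset \<tau>))"
proof (intro conjI allI impI iffI)
  note k = assms(1)
  show "one_coaffinity f \<ge> 6"
    using AGL_or_transpose_if_one_coaffinity_le_6[OF k assms(2)] assms(3) by linarith
  fix \<tau> :: "'k ^ 2 \<Rightarrow> 'k ^ 2"
  assume "is_transposition \<tau>"
  then obtain a b where ab: "a \<noteq> b" and \<tau>: "\<tau> = Transposition.transpose a b"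
    unfolding is_transposition_def by blast
  show "one_coaffinity f = 6" if "f \<in> AGL_double_coset \<tau>"
  proof -
    obtain \<alpha> \<beta> where "f = \<alpha> \<circ> \<tau> \<circ> \<beta>" "\<alpha> \<in> AGL" "\<beta> \<in> AGL"
      using \<open>f \<in> AGL_double_coset \<tau>\<close> unfolding AGL_double_coset_def by blast
    then have "one_coaffinity f = one_coaffinity \<tau>"
      using one_coaffinity_AGL_comp[OF k, of \<alpha> \<beta> \<tau>] by (simp only:)
    then show ?thesis using one_coaffinity_transpose[OF k ab] \<tau> by simp
  qed
  assume "one_coaffinity f = 6"
  then obtain a' b' where ab': "a' \<noteq> b'" and \<alpha>: "f \<circ> Transposition.transpose a' b' \<in> AGL"
    using AGL_or_transpose_if_one_coaffinity_le_6[OF k assms(2)] assms(3) by auto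
  \<comment> \<open>\<open>\<gamma>\<close> carries the pair moved by \<open>\<tau>\<close> to the
    pair found for \<open>f\<close>, so it conjugates \<open>\<tau>\<close> to the transposition of
    \<open>a'\<close> and \<open>b'\<close>.\<close>
  obtain \<gamma> where \<gamma>: "\<gamma> \<in> AGL" "\<gamma> a = a'" "\<gamma> b = b'"
    using AGL_two_transitive[OF k ab ab'] .
  have b: "bij \<gamma>" using \<gamma>(1) unfolding AGL_iff_sum_eq_0[OF k] by blast
  then have "inv \<gamma> a' = a" "inv \<gamma> b' = b" using \<gamma> by (auto simp: bij_is_inj)
  then have conj: "Transposition.transpose a' b' (\<gamma> x) = \<gamma> (\<tau> x)" for x
    using transpose_apply_commute[OF b, of a' b' x] by (simp add: \<tau>)
  \<comment> \<open>Write \<open>f\<close> as its affine composite with the transposition of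
    \<open>a'\<close> and \<open>b'\<close>, followed on the right by that involution again, and
    replace the latter by the conjugate of \<open>\<tau>\<close>.\<close>
  have "f = (f \<circ> Transposition.transpose a' b' \<circ> \<gamma>) \<circ> \<tau> \<circ> inv \<gamma>"
  proof
    fix x
    have "Transposition.transpose a' b' x = \<gamma> (\<tau> (inv \<gamma> x))"
      using conj[of "inv \<gamma> x"] b by (simp add: bij_is_surj surj_f_inv_f)
    then show "f x = ((f \<circ> Transposition.transpose a' b' \<circ> \<gamma>) \<circ> \<tau> \<circ> inv \<gamma>) x"
      using transpose_involutory[of a' b' x] by simp
  qed
  then show "f \<in> AGL_double_coset \<tau>"
    unfolding AGL_double_coset_def
    using AGL_comp[OF k \<alpha> \<gamma>(1)] AGL_inv[OF k \<gamma>(1)] by blast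
qed

end
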